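(* Let $G$ be a finite group of order $v$ and $J$ a subgroup of order $t$. Let $\lambda,m,n,h,k$ be positive integers with $h\le n$, $k\le m$ such that $nk=mh$, $v=\frac{2nk}{\lambda}+t$, $t\mid v$, and if $G\setminus J$ contains an involution then $\lambda$ is even. If $$\lambda\left(\frac{m}{mh-h+1}+\frac{n}{nk-k+1}\right)<1,$$ then there exists a ${}^\lambda\mathrm{NH}_t(m,n;h,k)$ over $G$ relative to $J$.
   Context: Groups are written additively (not necessarily abelian). An $m\times n$ partially filled (p.f.) array over $G$ is an $m\times n$ matrix each of whose cells is empty or contains an element of $G$. For a subgroup $J$ of order $t$, a ${}^\lambda\mathrm{NH}_t(m,n;h,k)$ over $G$ relative to $J$ is an $m\times n$ p.f. array $A$ over $G$ such that: (a) each row contains exactly $h$ filled cells and each column exactly $k$ filled cells; (b) the multiset obtained by taking, for every filled cell with entry $x$, both $x$ and $-x$ (with multiplicity, so an involution contributes twice), is exactly the multiset containing each element of $G\setminus J$ exactly $\lambda$ times; (c) each row sum taken left to right and each column sum taken top to bottom is nonzero. *)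

theory Defs
  imports Complex_Main "HOL-Library.Multiset" "HOL-Algebra.Coset"
begin

text \<open>
  Groups are HOL-Algebra groups, hence written multiplicatively: the sum, the negative and
  zero of an additively written group are the product, the inverse and the unit here.
  No commutativity is assumed.

  A partially filled array with \<open>m\<close> rows and \<open>n\<close> columns is a function \<open>A\<close> on
  indices \<open>i < m\<close>, \<open>j < n\<close>, where \<open>None\<close> marks an empty cell. Values of
  \<open>A\<close> outside this index range play no role.
\<close>

definition pf_array :: "('a, 'b) monoid_scheme \<Rightarrow> nat \<Rightarrow> nat \<Rightarrow> (nat \<Rightarrow> nat \<Rightarrow> 'a option) \<Rightarrow> bool" where
  "pf_array G m n A \<longleftrightarrow> (\<forall>i<m. \<forall>j<n. \<forall>x. A i j = Some x \<longrightarrow> x \<in> carrier G)"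

definition filled_cells :: "nat \<Rightarrow> nat \<Rightarrow> (nat \<Rightarrow> nat \<Rightarrow> 'a option) \<Rightarrow> (nat \<times> nat) set" where
  "filled_cells m n A = {(i, j). i < m \<and> j < n \<and> A i j \<noteq> None}"

text \<open>The entries of the filled cells of row \<open>i\<close> from left to right, and of column \<open>j\<close>
  from top to bottom.\<close>

definition row_entries :: "nat \<Rightarrow> (nat \<Rightarrow> nat \<Rightarrow> 'a option) \<Rightarrow> nat \<Rightarrow> 'a list" where
  "row_entries n A i = List.map_filter (\<lambda>j. A i j) [0..<n]"

definition col_entries :: "nat \<Rightarrow> (nat \<Rightarrow> nat \<Rightarrow> 'a option) \<Rightarrow> nat \<Rightarrow> 'a list" where
  "col_entries m A j = List.map_filter (\<lambda>i. A i j) [0..<m]"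

definition list_prod :: "('a, 'b) monoid_scheme \<Rightarrow> 'a list \<Rightarrow> 'a" where
  "list_prod G xs = foldr (mult G) xs \<one>\<^bsub>G\<^esub>"

definition is_involution :: "('a, 'b) monoid_scheme \<Rightarrow> 'a \<Rightarrow> bool" where
  "is_involution G x \<longleftrightarrow> x \<in> carrier G \<and> x \<noteq> \<one>\<^bsub>G\<^esub> \<and> x \<otimes>\<^bsub>G\<^esub> x = \<one>\<^bsub>G\<^esub>"

text \<open>\<open>is_NH G J lam t m n h k A\<close>: the array \<open>A\<close> is a
  \<open>\<^sup>\<lambda>NH\<^sub>t(m,n;h,k)\<close> over the finite group \<open>G\<close> relative to
  \<open>J\<close>, with \<open>lam\<close> for \<open>\<lambda>\<close>. Finiteness of \<open>G\<close> matters for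
  \<^const>\<open>mset_set\<close>, which is empty on infinite sets.\<close>

definition is_NH ::
    "('a, 'b) monoid_scheme \<Rightarrow> 'a set \<Rightarrow> nat \<Rightarrow> nat \<Rightarrow> nat \<Rightarrow> nat \<Rightarrow> nat \<Rightarrow> nat
      \<Rightarrow> (nat \<Rightarrow> nat \<Rightarrow> 'a option) \<Rightarrow> bool" where
  "is_NH G J lam t m n h k A \<longleftrightarrow>
     subgroup J G \<and> card J = t \<and> pf_array G m n A \<and>
     (\<forall>i<m. card {j. (i, j) \<in> filled_cells m n A} = h) \<and>
     (\<forall>j<n. card {i. (i, j) \<in> filled_cells m n A} = k) \<and>
     (\<Sum>(i, j)\<in>filled_cells m n A. {# the (A i j), inv\<^bsub>G\<^esub> (the (A i j)) #})
       = repeat_mset lam (mset_set (carrier G - J)) \<and>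
     (\<forall>i<m. list_prod G (row_entries n A i) \<noteq> \<one>\<^bsub>G\<^esub>) \<and>
     (\<forall>j<n. list_prod G (col_entries m A j) \<noteq> \<one>\<^bsub>G\<^esub>)"

end

theory Submission
  imports Defs "HOL-Combinatorics.Permutations"
begin

text \<open>
  Fix a shape with \<open>h\<close> cells in every row and \<open>k\<close> cells in every column, and a multiset of
  \<open>n k\<close> elements that contains exactly \<open>\<lambda>\<close> elements of every pair \<open>{x, -x}\<close> outside \<open>J\<close>
  (\<open>\<lambda> / 2\<close> copies if \<open>x\<close> is an involution). Distribute this multiset over
  the cells by a uniformly random permutation. Given the other
  entries of a row, its sum vanishes for only one value of its first entry; that value occurs at
  most \<open>\<lambda>\<close> times among the \<open>m h - h + 1\<close> remaining elements, so the sum of a fixed row vanishes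
  with probability at most \<open>\<lambda> / (m h - h + 1)\<close>. The same holds for columns, and the hypothesis
  is the union bound over all rows and columns.
\<close>

section \<open>Halving a multiset along an involution\<close>

text \<open>The orbits of \<open>s\<close> on \<open>X\<close> have one or two elements. An orbit of
  size two contributes \<open>l\<close> copies of one of its elements, a fixed point
  \<open>l / 2\<close> copies of itself. The induction removes one orbit at a time.\<close>

lemma ex_half_multiset:
  assumes "finite X" and "\<And>x. x \<in> X \<Longrightarrow> s x \<in> X" and "\<And>x. x \<in> X \<Longrightarrow> s (s x) = x"
    and "\<And>x. x \<in> X \<Longrightarrow> s x = x \<Longrightarrow> even l"
  shows "\<exists>M. M + image_mset s M = repeat_mset l (mset_set X)"
  using assms
proof (induction X rule: finite_psubset_induct)
  case (psubset X)
  show ?case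
  proof (cases "X = {}")
    case True
    then show ?thesis by (intro exI[of _ "{#}"]) simp
  next
    case False
    then obtain x where x: "x \<in> X" by blast
    define Y where "Y = X - {x, s x}"
    have "s y \<in> Y" if "y \<in> Y" for y
      using that psubset.prems(1,2) x unfolding Y_def by (metis Diff_iff insert_iff empty_iff)
    then have "\<exists>M. M + image_mset s M = repeat_mset l (mset_set Y)"
      using x psubset.prems by (intro psubset.IH) (auto simp: Y_def)
    then obtain M where M: "M + image_mset s M = repeat_mset l (mset_set Y)" by blast
    have fin: "finite Y" using psubset.hyps by (simp add: Y_def)
    show ?thesis
    proof (cases "s x = x")
      case True
      \<comment> \<open>\<open>M + image_mset s M\<close> counts a fixed point twice, so halving
        must be exact.\<close>
      have "l = l div 2 + l div 2"
        using psubset.prems(3)[OF x True] by (auto elim: evenE)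
      then have r: "replicate_mset (l div 2) x + replicate_mset (l div 2) x = replicate_mset l x"
        by (metis repeat_mset_distrib repeat_mset_replicate_mset)
      have "X = insert x Y" "x \<notin> Y" using x True by (auto simp: Y_def)
      then show ?thesis
        using fin M True r
        by (intro exI[of _ "M + replicate_mset (l div 2) x"])
           (simp add: algebra_simps flip: repeat_mset_distrib2)
    next
      case False
      have "X = insert x (insert (s x) Y)" "x \<notin> insert (s x) Y" "s x \<notin> Y"
        using x False psubset.prems(1) by (auto simp: Y_def)
      then show ?thesis
        using fin M
        by (intro exI[of _ "M + replicate_mset l x"])
           (simp add: algebra_simps)
    qed
  qed
qed

section \<open>Shapes with constant row and column counts\<close>

text \<open>Cell number \<open>c\<close> goes to row \<open>c div h\<close> and column
  \<open>c mod n\<close>: each row is a cyclic run of \<open>h\<close> columns that starts where the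
  previous row stopped. The total \<open>n * k = m * h\<close> fills \<open>m\<close> rows and
  passes \<open>k\<close> times through all columns.\<close>

lemma ex_biregular_cells:
  fixes m n h k :: nat
  assumes "n > 0" "h > 0" "h \<le> n" "n * k = m * h"
  obtains C where "C \<subseteq> {..<m} \<times> {..<n}" "card C = n * k"
    "\<And>i. i < m \<Longrightarrow> card {j. (i, j) \<in> C} = h" "\<And>j. j < n \<Longrightarrow> card {i. (i, j) \<in> C} = k"
proof -
  define \<phi> where "\<phi> = (\<lambda>c. (c div h, c mod n))"
  have inj: "inj_on \<phi> {..<n * k}"
  proof (rule inj_onI)
    have le: "a = b" if "a \<le> b" "\<phi> a = \<phi> b" for a b
    proof -
      \<comment> \<open>Numbers in the same row differ by less than \<open>h \<le> n\<close>,
        numbers in the same column by a multiple of \<open>n\<close>.\<close>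
      have "b - a < n"
      proof -
        have "b - a = b mod h - a mod h"
          using that by (metis \<phi>_def prod.inject
              add_diff_cancel_left div_mult_mod_eq)
        also have "\<dots> < h" using assms(2) by (simp add: less_imp_diff_less)
        finally show ?thesis using assms(3) by simp
      qed
      moreover have "n dvd b - a"
        using that by (simp add: \<phi>_def mod_eq_dvd_iff_nat[symmetric])
      ultimately show ?thesis using that(1) by (auto dest: nat_dvd_not_less)
    qed
    show "a = b" if "\<phi> a = \<phi> b" for a b
      using le[of a b] le[of b a] that by (metis nat_le_linear)
  qed
  define C where "C = \<phi> ` {..<n * k}"
  have cell_iff: "(i, j) \<in> C \<longleftrightarrow> (\<exists>c < n * k. i = c div h \<and> j = c mod n)" for i j
    by (auto simp: C_def \<phi>_def)
  show ?thesis
  proof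
    show "C \<subseteq> {..<m} \<times> {..<n}"
      using assms by (auto simp: C_def \<phi>_def less_mult_imp_div_less)
    show "card C = n * k" using inj by (simp add: C_def card_image)
    show "card {j. (i, j) \<in> C} = h" if "i < m" for i
    proof -
      have *: "i * h + r < n * k" if "r < h" for r
      proof -
        have "i * h + r < Suc i * h" using that by simp
        also have "\<dots> \<le> m * h" using \<open>i < m\<close> by (intro mult_le_mono1) simp
        finally show ?thesis using assms by simp
      qed
      have "bij_betw (\<lambda>r. (i * h + r) mod n) {..<h} {j. (i, j) \<in> C}"
      proof (rule bij_betw_imageI)
        show "inj_on (\<lambda>r. (i * h + r) mod n) {..<h}"
        proof (rule inj_onI)
          fix r s assume rs: "r \<in> {..<h}" "s \<in> {..<h}" "(i * h + r) mod n = (i * h + s) mod n"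
          then have "\<phi> (i * h + r) = \<phi> (i * h + s)" by (simp add: \<phi>_def)
          then show "r = s" using inj_onD[OF inj] * rs by fastforce
        qed
        show "(\<lambda>r. (i * h + r) mod n) ` {..<h} = {j. (i, j) \<in> C}"
        proof (intro equalityI subsetI)
          fix j assume "j \<in> (\<lambda>r. (i * h + r) mod n) ` {..<h}"
          then obtain r where "r < h" "j = (i * h + r) mod n" by auto
          then show "j \<in> {j. (i, j) \<in> C}"
            using *[of r] by (auto simp: cell_iff intro!: exI[of _ "i * h + r"])
        next
          fix j assume "j \<in> {j. (i, j) \<in> C}"
          then obtain c where "i = c div h" "j = c mod n" by (auto simp: cell_iff)
          then show "j \<in> (\<lambda>r. (i * h + r) mod n) ` {..<h}"
            using assms(2) by (intro image_eqI[of _ _ "c mod h"]) auto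
        qed
      qed
      then show ?thesis by (metis bij_betw_same_card card_lessThan)
    qed
    show "card {i. (i, j) \<in> C} = k" if "j < n" for j
    proof -
      have *: "q * n + j < n * k" if "q < k" for q
      proof -
        have "q * n + j < Suc q * n" using \<open>j < n\<close> by simp
        also have "\<dots> \<le> k * n" using that by (intro mult_le_mono1) simp
        finally show ?thesis by (simp add: mult.commute)
      qed
      \<comment> \<open>The cells of column \<open>j\<close> are those numbered
        \<open>q * n + j\<close>; two of them in the same row would contradict
        \<open>inj\<close>.\<close>
      have "bij_betw (\<lambda>q. (q * n + j) div h) {..<k} {i. (i, j) \<in> C}"
      proof (rule bij_betw_imageI)
        show "inj_on (\<lambda>q. (q * n + j) div h) {..<k}"
        proof (rule inj_onI)
          fix r s assume rs: "r \<in> {..<k}" "s \<in> {..<k}" "(r * n + j) div h = (s * n + j) div h"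
          then have "\<phi> (r * n + j) = \<phi> (s * n + j)" by (simp add: \<phi>_def)
          then have "r * n + j = s * n + j" using inj_onD[OF inj] * rs by blast
          then show "r = s" using assms(1) by simp
        qed
        show "(\<lambda>q. (q * n + j) div h) ` {..<k} = {i. (i, j) \<in> C}"
        proof (intro equalityI subsetI)
          fix i assume "i \<in> (\<lambda>q. (q * n + j) div h) ` {..<k}"
          then obtain q where "q < k" "i = (q * n + j) div h" by auto
          then show "i \<in> {i. (i, j) \<in> C}"
            using *[of q] \<open>j < n\<close> by (auto simp: cell_iff intro!: exI[of _ "q * n + j"])
        next
          fix i assume "i \<in> {i. (i, j) \<in> C}"
          then obtain c where "c < n * k" "i = c div h" "j = c mod n" by (auto simp: cell_iff)
          then show "i \<in> (\<lambda>q. (q * n + j) div h) ` {..<k}"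
            by (intro image_eqI[of _ _ "c div n"]) (auto simp: less_mult_imp_div_less mult.commute)
        qed
      qed
      then show ?thesis by (metis bij_betw_same_card card_lessThan)
    qed
  qed
qed

section \<open>Counting fillings with a trivial product\<close>

text \<open>
  Double counting of the pairs \<open>(p, d)\<close> with \<open>p \<circ> transpose c d \<in> B\<close>, where \<open>d\<close> ranges over \<open>c\<close>
  and the cells outside \<open>R\<close>: these transpositions leave the entries on \<open>R - {c}\<close> unchanged.
\<close>

lemma card_permutations_determined_entry:
  fixes f :: "'c \<Rightarrow> 'a"
  assumes "finite C" and "R \<subseteq> C" and "c \<in> R"
    and fibre: "\<And>x. card {d \<in> C. f d = x} \<le> l"
    and B: "B \<subseteq> {p. p permutes C}"
    and det: "\<And>p q. p \<in> B \<Longrightarrow> q \<in> B \<Longrightarrow> (\<And>d. d \<in> R - {c} \<Longrightarrow> p d = q d) \<Longrightarrow> f (p c) = f (q c)"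
  shows "(card C - card R + 1) * card B \<le> l * fact (card C)"
proof -
  define D where "D = insert c (C - R)"
  let ?P = "{p. p permutes C}"
  let ?S = "\<lambda>p. {d \<in> D. p \<circ> transpose c d \<in> B}"
  have D: "finite D" "card D = card C - card R + 1" "D \<subseteq> C"
    using assms by (auto simp: D_def card_Diff_subset finite_subset)
  have finP: "finite ?P" using assms(1) by (rule finite_permutations)
  \<comment> \<open>Composition with the involution \<open>transpose c d\<close> permutes
    \<open>?P\<close>, so each \<open>d\<close> contributes exactly \<open>card B\<close>
    pairs.\<close>
  have slice: "card {p \<in> ?P. p \<circ> transpose c d \<in> B} = card B" if "d \<in> D" for d
  proof -
    have t: "transpose c d permutes C" using that assms D by (intro permutes_swap_id) auto
    have "bij_betw (\<lambda>p. p \<circ> transpose c d) {p \<in> ?P. p \<circ> transpose c d \<in> B} B"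
      using B permutes_compose[OF t]
      by (intro bij_betw_byWitness[where f' = "\<lambda>p. p \<circ> transpose c d"])
         (auto simp: comp_assoc)
    then show ?thesis by (rule bij_betw_same_card)
  qed
  have "card D * card B = (\<Sum>d\<in>D. card {p \<in> ?P. p \<circ> transpose c d \<in> B})"
    using slice by simp
  also have "\<dots> = (\<Sum>p\<in>?P. card (?S p))"
    using sum.swap_restrict[OF D(1) finP, of "\<lambda>_ _. 1::nat" "\<lambda>d p. p \<circ> transpose c d \<in> B"] by simp
  also have "\<dots> \<le> (\<Sum>p\<in>?P. l)"
  proof (rule sum_mono)
    fix p assume "p \<in> ?P"
    then have p: "p permutes C" by simp
    show "card (?S p) \<le> l"
    proof (cases "?S p = {}")
      case False
      then obtain e where e: "e \<in> ?S p" by blast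
      \<comment> \<open>The two transposed permutations agree on \<open>R - {c}\<close> and send
        \<open>c\<close> to \<open>p d\<close> and \<open>p e\<close>, so \<open>det\<close>
        applies. Thus \<open>p\<close> maps \<open>?S p\<close> injectively into a single fibre of
        \<open>f\<close>.\<close>
      have "f (p d) = f (p e)" if "d \<in> ?S p" for d
      proof -
        have "transpose c d r = transpose c e r" if "r \<in> R - {c}" for r
          using that e \<open>d \<in> ?S p\<close> by (auto simp: D_def transpose_def)
        then show ?thesis
          using det[of "p \<circ> transpose c d" "p \<circ> transpose c e"] that e by simp
      qed
      then have "p ` ?S p \<subseteq> {d \<in> C. f d = f (p e)}"
        using D(3) permutes_in_image[OF p] by blast
      then have "card (p ` ?S p) \<le> l"
        using assms(1) by (intro order_trans[OF card_mono fibre[of "f (p e)"]]) auto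
      then show ?thesis using permutes_inj_on[OF p] by (simp add: card_image)
    next
      case True
      then show ?thesis by (simp only: card.empty le0)
    qed
  qed
  also have "\<dots> = l * fact (card C)"
    using assms(1) by (simp add: card_permutations[OF refl])
  finally show ?thesis by (simp only: D(2))
qed

lemma list_prod_closed:
  assumes "group G" and "set xs \<subseteq> carrier G"
  shows "list_prod G xs \<in> carrier G"
proof -
  interpret group G by fact
  show ?thesis using assms(2) by (induction xs) (auto simp: list_prod_def)
qed

text \<open>The first cell plays the role of \<open>c\<close>: its entry is the leftmost factor, so
  one right cancellation recovers it from the other entries without commutativity.\<close>

lemma card_permutations_trivial_prod:
  assumes "group G" and "finite C" and "f ` C \<subseteq> carrier G"
    and "\<And>x. card {d \<in> C. f d = x} \<le> l"
    and "distinct cs" and "set cs \<subseteq> C" and "cs \<noteq> []"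
  shows "(card C - length cs + 1) * card {p. p permutes C \<and> list_prod G (map (\<lambda>c. f (p c)) cs) = \<one>\<^bsub>G\<^esub>}
    \<le> l * fact (card C)"
proof -
  interpret group G by fact
  obtain c ds where cs: "cs = c # ds" using assms(7) by (cases cs) auto
  have "(card C - card (set cs) + 1) * card {p. p permutes C \<and> list_prod G (map (\<lambda>c. f (p c)) cs) = \<one>\<^bsub>G\<^esub>}
    \<le> l * fact (card C)"
  proof (rule card_permutations_determined_entry[where c = c and f = f])
    fix p q
    assume p: "p \<in> {p. p permutes C \<and> list_prod G (map (\<lambda>c. f (p c)) cs) = \<one>\<^bsub>G\<^esub>}"
      and q: "q \<in> {p. p permutes C \<and> list_prod G (map (\<lambda>c. f (p c)) cs) = \<one>\<^bsub>G\<^esub>}"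
      and eq: "\<And>d. d \<in> set cs - {c} \<Longrightarrow> p d = q d"
    define y where "y = list_prod G (map (\<lambda>c. f (q c)) ds)"
    have carr: "f (r d) \<in> carrier G" if "r permutes C" "d \<in> set cs" for r d
      using that assms(3,6) permutes_in_image[OF that(1)] by blast
    have y: "y = list_prod G (map (\<lambda>c. f (p c)) ds)"
      unfolding y_def using assms(5) cs
      by (intro arg_cong[where f = "list_prod G"] map_cong refl arg_cong[where f = f] eq[symmetric]) auto
    have "list_prod G (map g cs) = g c \<otimes>\<^bsub>G\<^esub> list_prod G (map g ds)" for g
      by (simp add: cs list_prod_def)
    then have "f (p c) \<otimes>\<^bsub>G\<^esub> y = \<one>\<^bsub>G\<^esub>" "f (q c) \<otimes>\<^bsub>G\<^esub> y = \<one>\<^bsub>G\<^esub>"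
      using p q y y_def by simp_all
    moreover have "y \<in> carrier G"
      unfolding y_def using carr q cs by (intro list_prod_closed assms(1)) auto
    ultimately show "f (p c) = f (q c)"
      using carr p q cs by (metis (mono_tags) list.set_intros(1) mem_Collect_eq right_cancel)
  qed (use assms cs in auto)
  then show ?thesis using assms(5) by (simp add: distinct_card)
qed

section \<open>Arrays from random fillings\<close>

lemma map_filter_if:
  "List.map_filter (\<lambda>x. if P x then Some (g x) else None) xs = map g (filter P xs)"
  by (induction xs) auto

lemma length_filter_upt:
  assumes "\<And>j. P j \<Longrightarrow> j < n"
  shows "length (filter P [0..<n]) = card {j. P j}"
proof -
  have "length (filter P [0..<n]) = card (set (filter P [0..<n]))"
    by (simp add: distinct_card del: set_filter)
  also have "set (filter P [0..<n]) = {j. P j}" using assms by auto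
  finally show ?thesis .
qed

theorem theorem4p1:
  fixes G :: "('a, 'b) monoid_scheme" and J :: "'a set"
    and v t lam m n h k :: nat
  assumes "group G" and "finite (carrier G)" and "order G = v"
    and "subgroup J G" and "card J = t"
    and "lam > 0" and "m > 0" and "n > 0" and "h > 0" and "k > 0"
    and "h \<le> n" and "k \<le> m"
    and "n * k = m * h"
    and "real v = 2 * real n * real k / real lam + real t"
    and "t dvd v"
    and "(\<exists>x \<in> carrier G - J. is_involution G x) \<longrightarrow> even lam"
    and "real lam * (real m / (real m * real h - real h + 1)
                   + real n / (real n * real k - real k + 1)) < 1"
  shows "\<exists>A. is_NH G J lam t m n h k A"
proof -
  interpret group G by fact
  interpret J: subgroup J G by fact
  let ?X = "carrier G - J"
  have finX: "finite ?X" using assms(2) by simp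
  \<comment> \<open>The unit lies in \<open>J\<close>, so a self-inverse element outside
    \<open>J\<close> is an involution and the parity hypothesis applies.\<close>
  have "even lam" if "x \<in> ?X" "inv\<^bsub>G\<^esub> x = x" for x
  proof -
    have "x \<otimes>\<^bsub>G\<^esub> x = \<one>\<^bsub>G\<^esub>" using that r_inv[of x] by simp
    moreover have "x \<noteq> \<one>\<^bsub>G\<^esub>" using that J.one_closed by auto
    ultimately have "is_involution G x" using that by (simp add: is_involution_def)
    then show ?thesis using that assms(16) by blast
  qed
  moreover have "inv\<^bsub>G\<^esub> x \<in> ?X" if "x \<in> ?X" for x
    using that J.m_inv_closed[of "inv\<^bsub>G\<^esub> x"] by auto
  ultimately obtain M where M: "M + image_mset (\<lambda>x. inv\<^bsub>G\<^esub> x) M = repeat_mset lam (mset_set ?X)"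
    using ex_half_multiset[OF finX, of "\<lambda>x. inv\<^bsub>G\<^esub> x" lam] by auto
  have setM: "set_mset M \<subseteq> ?X"
  proof
    fix x assume "x \<in># M"
    then have "x \<in># repeat_mset lam (mset_set ?X)" by (metis M union_iff)
    then show "x \<in> ?X"
      using finX by (auto simp: count_mset_set' simp flip: count_greater_zero_iff split: if_splits)
  qed
  have countM: "count M x \<le> lam" for x
  proof -
    have "count M x \<le> count (repeat_mset lam (mset_set ?X)) x" by (simp flip: M)
    also have "\<dots> \<le> lam" using finX by (simp add: count_mset_set')
    finally show ?thesis .
  qed
  \<comment> \<open>Comparing sizes in \<open>M\<close> turns the formula for \<open>v\<close> into
    one element of \<open>M\<close> per cell.\<close>
  have "card ?X = v - t" "t \<le> v"
    using assms(2,3,5) J.subset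
    by (auto simp: order_def card_Diff_subset finite_subset card_mono)
  then have "real (lam * card ?X) = real (2 * (n * k))"
    using assms(6,14) by (simp add: field_simps)
  then have "lam * card ?X = 2 * (n * k)" by (simp only: of_nat_eq_iff)
  moreover have "size M + size M = lam * card ?X"
    using arg_cong[OF M, of size] by simp
  ultimately have sizeM: "size M = n * k" by simp

  obtain C where C: "C \<subseteq> {..<m} \<times> {..<n}" and cardC: "card C = n * k"
    and row: "\<And>i. i < m \<Longrightarrow> card {j. (i, j) \<in> C} = h"
    and col: "\<And>j. j < n \<Longrightarrow> card {i. (i, j) \<in> C} = k"
    using ex_biregular_cells assms(8,9,11,13) by metis
  have finC: "finite C" using C by (rule finite_subset) simp
  \<comment> \<open>A listing of \<open>M\<close> and a numbering of the cells give one filling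
    \<open>f\<close> with entries \<open>M\<close>; the others considered are \<open>f\<close>
    composed with permutations of \<open>C\<close>.\<close>
  obtain xs where xs: "mset xs = M" using ex_mset by blast
  obtain b where b: "bij_betw b C {0..<n * k}"
    using ex_bij_betw_finite_nat[OF finC] cardC by auto
  define f where "f = (\<lambda>c. xs ! b c)"
  have fM: "image_mset f (mset_set C) = M"
  proof -
    have "image_mset f (mset_set C) = image_mset ((!) xs) (image_mset b (mset_set C))"
      by (simp add: f_def multiset.map_comp comp_def)
    also have "image_mset b (mset_set C) = mset_set {0..<length xs}"
      using b sizeM xs by (metis bij_betw_imp_inj_on bij_betw_imp_surj_on image_mset_mset_set size_mset)
    also have "image_mset ((!) xs) \<dots> = M"
      using xs by (metis map_nth mset_map mset_upt)
    finally show ?thesis .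
  qed
  have fC: "f ` C \<subseteq> ?X" using setM finC by (auto simp flip: fM)
  have fibre: "card {d \<in> C. f d = x} \<le> lam" for x
  proof -
    have "count (image_mset f (mset_set C)) x = card {d \<in> C. f d = x}"
      using finC by (auto simp: count_image_mset' intro!: arg_cong[where f = card])
    then show ?thesis using countM[of x] fM by simp
  qed

  \<comment> \<open>Cells are listed in reading order, since the products depend on it.\<close>
  define rs where "rs = (\<lambda>i. map (Pair i) (filter (\<lambda>j. (i, j) \<in> C) [0..<n]))"
  define cs where "cs = (\<lambda>j. map (\<lambda>i. (i, j)) (filter (\<lambda>i. (i, j) \<in> C) [0..<m]))"
  define bad where "bad = (\<lambda>xs. {p. p permutes C \<and> list_prod G (map (\<lambda>c. f (p c)) xs) = \<one>\<^bsub>G\<^esub>})"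
  have len_rs: "length (rs i) = h" if "i < m" for i
    using that C row by (auto simp: rs_def length_filter_upt subset_iff)
  have len_cs: "length (cs j) = k" if "j < n" for j
    using that C col by (auto simp: cs_def length_filter_upt subset_iff)
  have bad: "real (card (bad xs)) \<le> real lam * fact (n * k) / (real (n * k) - real (length xs) + 1)"
    if "distinct xs" "set xs \<subseteq> C" "xs \<noteq> []" for xs
  proof -
    \<comment> \<open>This keeps the subtraction of naturals from being truncated, so that it agrees
      with the real one.\<close>
    have le: "length xs \<le> n * k"
      using that finC cardC by (metis card_mono distinct_card)
    have "(n * k - length xs + 1) * card (bad xs) \<le> lam * fact (n * k)"
      unfolding bad_def cardC[symmetric] using that fC fibre finC
      by (intro card_permutations_trivial_prod assms(1)) auto
    then have "real ((n * k - length xs + 1) * card (bad xs)) \<le> real (lam * fact (n * k))"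
      by (simp only: of_nat_le_iff)
    then have "real (card (bad xs)) \<le> real lam * fact (n * k) / real (n * k - length xs + 1)"
      by (simp only: pos_le_divide_eq of_nat_mult of_nat_fact mult.commute of_nat_0_less_iff)
    moreover have "real (n * k - length xs + 1) = real (n * k) - real (length xs) + 1"
      using le by (simp del: of_nat_mult)
    ultimately show ?thesis by (simp only:)
  qed
  have bad_row: "real (card (bad (rs i))) \<le> real lam * fact (n * k) / (real m * real h - real h + 1)"
    if "i < m" for i
  proof -
    have "rs i \<noteq> []" using len_rs[OF that] assms(9) by auto
    then have "real (card (bad (rs i))) \<le> real lam * fact (n * k) / (real (n * k) - real (length (rs i)) + 1)"
      by (intro bad) (auto simp: rs_def distinct_map inj_on_def)
    moreover have "real (n * k) = real m * real h" using assms(13) by simp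
    ultimately show ?thesis by (simp only: len_rs[OF that])
  qed
  have bad_col: "real (card (bad (cs j))) \<le> real lam * fact (n * k) / (real n * real k - real k + 1)"
    if "j < n" for j
  proof -
    have "cs j \<noteq> []" using len_cs[OF that] assms(10) by auto
    then have "real (card (bad (cs j))) \<le> real lam * fact (n * k) / (real (n * k) - real (length (cs j)) + 1)"
      by (intro bad) (auto simp: cs_def distinct_map inj_on_def)
    then show ?thesis by (simp only: len_cs[OF that] of_nat_mult)
  qed
  let ?B = "(\<Union>i<m. bad (rs i)) \<union> (\<Union>j<n. bad (cs j))"
  have finB: "finite ?B"
    by (rule finite_subset[OF _ finite_permutations[OF finC]]) (auto simp: bad_def)
  \<comment> \<open>The union bound in counting form: the hypothesis is scaled by
    \<open>fact (n * k)\<close>, the number of permutations of \<open>C\<close>.\<close>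
  have "real (card ?B) \<le> real ((\<Sum>i<m. card (bad (rs i))) + (\<Sum>j<n. card (bad (cs j))))"
    unfolding of_nat_le_iff
    by (intro order_trans[OF card_Un_le] add_mono card_UN_le) auto
  also have "\<dots> = (\<Sum>i<m. real (card (bad (rs i)))) + (\<Sum>j<n. real (card (bad (cs j))))"
    by simp
  also have "\<dots> \<le> (\<Sum>i<m. real lam * fact (n * k) / (real m * real h - real h + 1))
      + (\<Sum>j<n. real lam * fact (n * k) / (real n * real k - real k + 1))"
    using bad_row bad_col by (intro add_mono sum_mono) auto
  also have "\<dots> = real lam * (real m / (real m * real h - real h + 1)
                   + real n / (real n * real k - real k + 1)) * fact (n * k)"
    by (simp add: algebra_simps)
  also have "\<dots> < 1 * fact (n * k)"
    using assms(17) by (intro mult_strict_right_mono) auto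
  also have "\<dots> = real (card {p. p permutes C})"
    using finC cardC by (simp add: card_permutations[OF refl])
  finally have "card ?B < card {p. p permutes C}" by simp
  then have "\<not> {p. p permutes C} \<subseteq> ?B"
    using finB by (meson card_mono leD)
  then obtain p where p: "p permutes C" and good: "p \<notin> ?B" by blast

  define A where "A = (\<lambda>i j. if (i, j) \<in> C then Some (f (p (i, j))) else None)"
  have filled: "filled_cells m n A = C"
    using C by (auto simp: filled_cells_def A_def split: if_splits)
  have "list_prod G (row_entries n A i) \<noteq> \<one>\<^bsub>G\<^esub>" if "i < m" for i
    using good that p
    by (auto simp: bad_def row_entries_def A_def map_filter_if rs_def comp_def)
  moreover have "list_prod G (col_entries m A j) \<noteq> \<one>\<^bsub>G\<^esub>" if "j < n" for j
    using good that p
    by (auto simp: bad_def col_entries_def A_def map_filter_if cs_def comp_def)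
  moreover have "pf_array G m n A"
    using fC permutes_in_image[OF p] by (auto simp: pf_array_def A_def)
  moreover have "(\<Sum>(i, j)\<in>filled_cells m n A. {# the (A i j), inv\<^bsub>G\<^esub> (the (A i j)) #})
      = repeat_mset lam (mset_set ?X)"
  proof -
    have "(\<Sum>(i, j)\<in>filled_cells m n A. {# the (A i j), inv\<^bsub>G\<^esub> (the (A i j)) #})
        = (\<Sum>c\<in>C. {# f (p c), inv\<^bsub>G\<^esub> (f (p c)) #})"
      unfolding filled by (intro sum.cong) (auto simp: A_def)
    \<comment> \<open>Rearranging entries does not change their multiset, so this condition holds
      for every \<open>p\<close>; only the row and column products need a good one.\<close>
    also have "\<dots> = (\<Sum>c\<in>C. {# f c, inv\<^bsub>G\<^esub> (f c) #})"
      using sum.permute[OF p, of "\<lambda>c. {# f c, inv\<^bsub>G\<^esub> (f c) #}"] by (simp add: comp_def)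
    also have "\<dots> = image_mset f (mset_set C) + image_mset (\<lambda>x. inv\<^bsub>G\<^esub> x) (image_mset f (mset_set C))"
      using finC by (induction C rule: finite_induct) auto
    finally show ?thesis using M by (simp only: fM)
  qed
  ultimately have "is_NH G J lam t m n h k A"
    using assms(4,5) row col by (simp add: is_NH_def filled)
  then show ?thesis by blast
qed

end
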